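(* Let $G$ be a Tychonoff paratopological group that is not locally compact. Then either every remainder of $G$ has the Baire property (i.e. is a Baire space), or every remainder of $G$ is both meager and Lindelöf.
   Context: All spaces are assumed to be Tychonoff. A paratopological group is a group $G$ with a topology such that the product map $G\times G\to G$, $(x,y)\mapsto xy$, is jointly continuous (inversion is not assumed continuous). A remainder of a space $X$ is the subspace $bX\setminus X$ of a Hausdorff compactification $bX$ of $X$. A space is Baire (has the Baire property) if the intersection of every sequence of open dense subsets is dense. A space is meager if it can be represented as the union of a sequence of its nowhere dense subsets. *)

theory Defs
  imports "HOL-Analysis.Analysis" "HOL-Algebra.Group"
begin

definition tychonoff_space :: "'a topology \<Rightarrow> bool" where
  "tychonoff_space X \<longleftrightarrow> Hausdorff_space X \<and> completely_regular_space X"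

locale paratopological_group = group G for G (structure) +
  fixes T :: "'a topology"
  assumes topspace_carrier: "topspace T = carrier G"
    and continuous_mult: "continuous_map (prod_topology T T) T (\<lambda>(x, y). x \<otimes> y)"

text \<open>A compactification of \<open>X\<close> is a compact Hausdorff space \<open>K\<close> together with a dense embedding
  \<open>e\<close>, so that the space usually written \<open>bX \ X\<close> is \<open>K\<close> without the image of \<open>e\<close>.\<close>

definition hausdorff_compactification :: "'a topology \<Rightarrow> 'b topology \<Rightarrow> ('a \<Rightarrow> 'b) \<Rightarrow> bool" where
  "hausdorff_compactification X K e \<longleftrightarrow>
     compact_space K \<and> Hausdorff_space K \<and> embedding_map X K e \<and>
     K closure_of (e ` topspace X) = topspace K"

definition remainder :: "'a topology \<Rightarrow> 'b topology \<Rightarrow> ('a \<Rightarrow> 'b) \<Rightarrow> 'b topology" where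
  "remainder X K e = subtopology K (topspace K - e ` topspace X)"

definition baire_space :: "'a topology \<Rightarrow> bool" where
  "baire_space X \<longleftrightarrow>
     (\<forall>U :: nat \<Rightarrow> 'a set. (\<forall>n. openin X (U n) \<and> X closure_of U n = topspace X) \<longrightarrow>
        X closure_of (\<Inter>n. U n) = topspace X)"

definition nowhere_dense_in :: "'a topology \<Rightarrow> 'a set \<Rightarrow> bool" where
  "nowhere_dense_in X S \<longleftrightarrow> S \<subseteq> topspace X \<and> X interior_of (X closure_of S) = {}"

definition meager_space :: "'a topology \<Rightarrow> bool" where
  "meager_space X \<longleftrightarrow>
     (\<exists>N :: nat \<Rightarrow> 'a set. (\<forall>n. nowhere_dense_in X (N n)) \<and> topspace X = (\<Union>n. N n))"

end

theory Submission
  imports Defs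
begin

text \<open>If some remainder of \<open>G\<close>, in a compactification \<open>K\<close>, is not Baire, then, remainders of a
  nowhere locally compact space being dense, \<open>G\<close> contains a set that is residual in some nonempty
  open subset of \<open>K\<close>. This property passes to every other compactification \<open>L\<close> of \<open>G\<close>, and by
  homogeneity it then holds near every point of \<open>L\<close>, so the remainder in \<open>L\<close> has a \<open>\<pi>\<close>-base of
  meager open sets and is meager by the Banach category theorem. The residual set also yields a
  nonempty compact \<open>F \<subseteq> G\<close> of countable character. For every compact \<open>C\<close> the product \<open>C F\<close> again
  has countable character, so \<open>G\<close> is of countable type and its remainders are Lindelof.\<close>

no_notation eq_closure_of (\<open>closure'_of\<index>\<close>)

section \<open>Nowhere dense sets and the Banach category theorem\<close>

text \<open>Empty interior means that no nonempty open \<open>U\<close> lies in the closure of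
  \<open>S\<close>, so \<open>U\<close> minus that closure serves as \<open>V\<close>; conversely an
  open \<open>V\<close> missing \<open>S\<close> misses its closure too.\<close>

lemma nowhere_dense_in_iff:
  "nowhere_dense_in X S \<longleftrightarrow> S \<subseteq> topspace X \<and>
     (\<forall>U. openin X U \<and> U \<noteq> {} \<longrightarrow> (\<exists>V. openin X V \<and> V \<noteq> {} \<and> V \<subseteq> U \<and> V \<inter> S = {}))"
proof (cases "S \<subseteq> topspace X")
  case True
  have "X interior_of (X closure_of S) = {} \<longleftrightarrow>
      (\<forall>U. openin X U \<and> U \<noteq> {} \<longrightarrow> \<not> U \<subseteq> X closure_of S)"
    by (metis interior_of_eq_empty)
  also have "\<dots> \<longleftrightarrow>
      (\<forall>U. openin X U \<and> U \<noteq> {} \<longrightarrow> (\<exists>V. openin X V \<and> V \<noteq> {} \<and> V \<subseteq> U \<and> V \<inter> S = {}))"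
  proof (intro all_cong1 imp_cong refl iffI)
    fix U assume U: "openin X U \<and> U \<noteq> {}"
    show "\<exists>V. openin X V \<and> V \<noteq> {} \<and> V \<subseteq> U \<and> V \<inter> S = {}" if "\<not> U \<subseteq> X closure_of S"
    proof (intro exI conjI)
      show "openin X (U - X closure_of S)"
        using U by (simp add: openin_diff)
      show "(U - X closure_of S) \<inter> S = {}"
        using closure_of_subset[OF True] by blast
    qed (use that in auto)
    show "\<not> U \<subseteq> X closure_of S" if "\<exists>V. openin X V \<and> V \<noteq> {} \<and> V \<subseteq> U \<and> V \<inter> S = {}"
      using that by (metis Int_absorb2 Int_commute openin_Int_closure_of_eq_empty subset_trans)
  qed
  finally show ?thesis
    using True by (simp add: nowhere_dense_in_def)
qed (simp add: nowhere_dense_in_def)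

text \<open>The Banach category theorem. Disjointness of the family is what makes the unions of the
  \<open>n\<close>-th pieces nowhere dense again.\<close>

lemma meager_space_if_pi_base:
  assumes "\<And>U. openin X U \<Longrightarrow> U \<noteq> {} \<Longrightarrow>
    \<exists>V N. openin X V \<and> V \<noteq> {} \<and> V \<subseteq> U \<and> (\<forall>n::nat. nowhere_dense_in X (N n)) \<and> V \<subseteq> (\<Union>n. N n)"
  shows "meager_space X"
proof -
  define M where "M = {V. openin X V \<and> V \<noteq> {} \<and>
    (\<exists>N. (\<forall>n::nat. nowhere_dense_in X (N n)) \<and> V \<subseteq> (\<Union>n. N n))}"
  have "\<exists>\<U>\<in>{\<U>. \<U> \<subseteq> M \<and> disjoint \<U>}. \<forall>\<V>\<in>{\<U>. \<U> \<subseteq> M \<and> disjoint \<U>}. \<U> \<subseteq> \<V> \<longrightarrow> \<V> = \<U>"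
  proof (rule subset_Zorn')
    fix C assume C: "subset.chain {\<U>. \<U> \<subseteq> M \<and> disjoint \<U>} C"
    then have sub: "\<And>\<U>. \<U> \<in> C \<Longrightarrow> \<U> \<subseteq> M \<and> disjoint \<U>"
      and lin: "\<And>\<U> \<V>. \<U> \<in> C \<Longrightarrow> \<V> \<in> C \<Longrightarrow> \<U> \<subseteq> \<V> \<or> \<V> \<subseteq> \<U>"
      by (auto simp: subset_chain_def)
    have "disjoint (\<Union>C)"
      using sub lin by (intro pairwise_chain_Union) (auto simp: chain_subset_def)
    then show "\<Union>C \<in> {\<U>. \<U> \<subseteq> M \<and> disjoint \<U>}"
      using sub by blast
  qed
  then obtain \<U> where *: "\<U> \<in> {\<U>. \<U> \<subseteq> M \<and> disjoint \<U>}"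
    "\<forall>\<V>\<in>{\<U>. \<U> \<subseteq> M \<and> disjoint \<U>}. \<U> \<subseteq> \<V> \<longrightarrow> \<V> = \<U>"
    by (rule bexE)
  then have \<U>: "\<U> \<subseteq> M" "disjoint \<U>"
    by simp_all
  have maximal: "\<V> = \<U>" if "\<V> \<subseteq> M" "disjoint \<V>" "\<U> \<subseteq> \<V>" for \<V>
    using bspec[OF *(2), of \<V>] that by simp
  have open\<U>: "openin X U" if "U \<in> \<U>" for U
    using that \<U> by (auto simp: M_def)
  \<comment> \<open>Maximality makes \<open>\<Union>\<U>\<close> dense: an open set missing it would
    contain a member of \<open>M\<close> that could be added to the family.\<close>
  have meets: "\<exists>U\<in>\<U>. O' \<inter> U \<noteq> {}" if O': "openin X O'" "O' \<noteq> {}" for O'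
  proof (rule ccontr)
    assume "\<not> ?thesis"
    then have dis: "\<And>U. U \<in> \<U> \<Longrightarrow> O' \<inter> U = {}"
      by blast
    obtain V where V: "V \<in> M" "V \<subseteq> O'"
      using assms[OF O'] unfolding M_def by blast
    then have "V \<noteq> {}"
      by (simp add: M_def)
    have "disjoint (insert V \<U>)"
      using \<U>(2) dis V(2) by (auto simp: pairwise_insert disjnt_def)
    then have "insert V \<U> = \<U>"
      using maximal[of "insert V \<U>"] V \<U> by blast
    then show False
      using dis[of V] V \<open>V \<noteq> {}\<close> by blast
  qed
  have "\<forall>U\<in>\<U>. \<exists>N. (\<forall>n::nat. nowhere_dense_in X (N n)) \<and> U \<subseteq> (\<Union>n. N n)"
    using \<U>(1) by (auto simp: M_def)
  then obtain N where N: "\<And>U n. U \<in> \<U> \<Longrightarrow> nowhere_dense_in X (N U n)"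
      "\<And>U. U \<in> \<U> \<Longrightarrow> U \<subseteq> (\<Union>n::nat. N U n)"
    by metis
  define E where "E n = (\<Union>U\<in>\<U>. U \<inter> N U n)" for n
  have E: "nowhere_dense_in X (E n)" for n
    unfolding nowhere_dense_in_iff
  proof (intro conjI allI impI)
    show "E n \<subseteq> topspace X"
      using open\<U> openin_subset by (fastforce simp: E_def)
    fix O' assume O': "openin X O' \<and> O' \<noteq> {}"
    then obtain U where U: "U \<in> \<U>" "O' \<inter> U \<noteq> {}"
      using meets by blast
    have "openin X (O' \<inter> U)"
      using O' U open\<U> by blast
    then obtain V where V: "openin X V" "V \<noteq> {}" "V \<subseteq> O' \<inter> U" "V \<inter> N U n = {}"
      using N(1)[OF U(1), of n] U(2) unfolding nowhere_dense_in_iff by meson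
    have "V \<inter> E n = {}"
    proof -
      have "V \<inter> (U' \<inter> N U' n) = {}" if "U' \<in> \<U>" for U'
        using V pairwiseD[OF \<U>(2) U(1) that] by (cases "U = U'") (auto simp: disjnt_def)
      then show ?thesis
        by (auto simp: E_def)
    qed
    then show "\<exists>V. openin X V \<and> V \<noteq> {} \<and> V \<subseteq> O' \<and> V \<inter> E n = {}"
      using V by blast
  qed
  have R: "nowhere_dense_in X (topspace X - \<Union>\<U>)"
    unfolding nowhere_dense_in_iff
  proof (intro conjI allI impI)
    fix O' assume O': "openin X O' \<and> O' \<noteq> {}"
    then obtain U where U: "U \<in> \<U>" "O' \<inter> U \<noteq> {}"
      using meets by blast
    then show "\<exists>V. openin X V \<and> V \<noteq> {} \<and> V \<subseteq> O' \<and> V \<inter> (topspace X - \<Union>\<U>) = {}"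
      using O' open\<U> by (intro exI[of _ "O' \<inter> U"]) auto
  qed auto
  \<comment> \<open>Index 0 is reserved for the points outside \<open>\<Union>\<U>\<close>, which
    form a nowhere dense set; the pieces \<open>E m\<close> are shifted by one.\<close>
  define N' where "N' n = (case n of 0 \<Rightarrow> topspace X - \<Union>\<U> | Suc m \<Rightarrow> E m)" for n
  have N': "nowhere_dense_in X (N' n)" for n
    using E R by (simp add: N'_def split: nat.split)
  have "topspace X = (\<Union>n. N' n)"
  proof
    show "topspace X \<subseteq> (\<Union>n. N' n)"
    proof
      fix x assume x: "x \<in> topspace X"
      show "x \<in> (\<Union>n. N' n)"
      proof (cases "x \<in> \<Union>\<U>")
        case True
        then obtain U where U: "U \<in> \<U>" "x \<in> U"
          by blast
        then obtain n where "x \<in> N U n"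
          using N(2) by blast
        then have "x \<in> N' (Suc n)"
          using U by (auto simp: N'_def E_def)
        then show ?thesis
          by blast
      next
        case False
        then have "x \<in> N' 0"
          using x by (simp add: N'_def)
        then show ?thesis
          by blast
      qed
    qed
    show "(\<Union>n. N' n) \<subseteq> topspace X"
      using N' by (auto simp: nowhere_dense_in_def)
  qed
  then show ?thesis
    unfolding meager_space_def using N' by blast
qed

section \<open>Residual sets and compact sets of countable character\<close>

lemma regular_space_shrink:
  assumes "regular_space X" "openin X U" "x \<in> U"
  obtains V where "openin X V" "x \<in> V" "X closure_of V \<subseteq> U"
proof -
  have "neighbourhood_base_of (closedin X) X"
    using assms(1) by (simp add: neighbourhood_base_of_closedin)
  then obtain V C where "openin X V" "closedin X C" "x \<in> V" "V \<subseteq> C" "C \<subseteq> U"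
    using assms unfolding neighbourhood_base_of by meson
  then show thesis
    using that by (meson closure_of_minimal order_trans)
qed

text \<open>The sets \<open>D n\<close> are dense in all of \<open>K\<close>, not only in
  \<open>V\<close>, so that they can be moved to another compactification or traced on the remainder
  independently of \<open>V\<close>. Nothing is lost, since the complement of the closure of
  \<open>V\<close> can be added to a set that is dense in \<open>V\<close>.\<close>

definition residual_in :: "'b topology \<Rightarrow> 'b set \<Rightarrow> 'b set \<Rightarrow> bool" where
  "residual_in K V A \<longleftrightarrow>
     (\<exists>D :: nat \<Rightarrow> 'b set. (\<forall>n. openin K (D n) \<and> K closure_of D n = topspace K) \<and>
        V \<inter> (\<Inter>n. D n) \<subseteq> A)"

text \<open>The construction behind the Baire category theorem: \<open>U \<inter> D n\<close> is
  nonempty by density, regularity places a smaller closure inside it, and dependent choice iterates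
  this.\<close>

lemma nested_open_sets:
  assumes reg: "regular_space K" and V: "openin K V" "V \<noteq> {}"
    and D: "\<And>n. openin K (D n)" "\<And>n. K closure_of D n = topspace K"
  shows "\<exists>B :: nat \<Rightarrow> 'b set. \<forall>n. (openin K (B n) \<and> B n \<noteq> {} \<and> B n \<subseteq> V) \<and>
    K closure_of B (Suc n) \<subseteq> B n \<inter> D n"
proof (rule dependent_nat_choice)
  show "\<exists>U. openin K U \<and> U \<noteq> {} \<and> U \<subseteq> V"
    using V by blast
  fix U n
  assume U: "openin K U \<and> U \<noteq> {} \<and> U \<subseteq> V"
  then obtain x where x: "x \<in> U \<inter> D n"
    using D dense_intersects_open[of K "D n"] by blast
  have "openin K (U \<inter> D n)"
    using U D by blast
  then obtain W where W: "openin K W" "x \<in> W" "K closure_of W \<subseteq> U \<inter> D n"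
    using regular_space_shrink[OF reg _ x] by blast
  moreover have "W \<subseteq> K closure_of W"
    using W by (simp add: closure_of_subset openin_subset)
  ultimately show "\<exists>W. (openin K W \<and> W \<noteq> {} \<and> W \<subseteq> V) \<and> K closure_of W \<subseteq> U \<inter> D n"
    using U by blast
qed

text \<open>The intersection of the nested sets is the compact set, and the sets themselves form its
  neighbourhood base.\<close>

lemma compact_set_of_countable_character:
  assumes K: "compact_space K" "Hausdorff_space K" and V: "openin K V" "V \<noteq> {}"
    and res: "residual_in K V A"
  obtains F and B :: "nat \<Rightarrow> 'b set" where "compactin K F" "F \<noteq> {}" "F \<subseteq> A"
    "\<forall>n. openin K (B n) \<and> F \<subseteq> B n" "\<forall>U. openin K U \<and> F \<subseteq> U \<longrightarrow> (\<exists>n. B n \<subseteq> U)"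
proof -
  obtain D :: "nat \<Rightarrow> 'b set" where D': "\<forall>n. openin K (D n) \<and> K closure_of D n = topspace K"
      "V \<inter> (\<Inter>n. D n) \<subseteq> A"
    using res unfolding residual_in_def by (elim exE conjE) (rule that)
  then have D: "\<And>n. openin K (D n)" "\<And>n. K closure_of D n = topspace K" "V \<inter> (\<Inter>n. D n) \<subseteq> A"
    by simp_all
  have "\<exists>B. \<forall>n. (openin K (B n) \<and> B n \<noteq> {} \<and> B n \<subseteq> V) \<and> K closure_of B (Suc n) \<subseteq> B n \<inter> D n"
    by (rule nested_open_sets[OF compact_Hausdorff_imp_regular_space[OF K] V D(1,2)])
  then obtain B where "\<forall>n. (openin K (B n) \<and> B n \<noteq> {} \<and> B n \<subseteq> V) \<and>
      K closure_of B (Suc n) \<subseteq> B n \<inter> D n"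
    by (rule exE)
  then have B: "\<And>n. openin K (B n)" "\<And>n. B n \<noteq> {}" "\<And>n. B n \<subseteq> V"
      "\<And>n. K closure_of B (Suc n) \<subseteq> B n \<inter> D n"
    by simp_all
  have sub: "B n \<subseteq> K closure_of B n" for n
    by (simp add: B closure_of_subset openin_subset)
  have dec: "decseq B"
    using B(4) sub by (intro decseq_SucI) blast
  then have decC: "decseq (\<lambda>n. K closure_of B n)"
    by (simp add: decseq_def closure_of_mono)
  \<comment> \<open>Each closure lies in the preceding open set, so \<open>F\<close> is contained in
    every \<open>B n\<close> although it is an intersection of closed sets.\<close>
  define F where "F = (\<Inter>n. K closure_of B n)"
  have FB: "F \<subseteq> B n" for n
    using B(4)[of n] by (auto simp: F_def)
  have "closedin K F"
    unfolding F_def by (intro closedin_Inter) auto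
  then have 1: "compactin K F"
    using K closedin_compact_space by blast
  have 2: "F \<noteq> {}"
    unfolding F_def
  proof (rule compact_space_imp_nest[OF K(1)])
    show "K closure_of B n \<noteq> {}" for n
      using B(2) sub by blast
  qed (use decC in auto)
  have "F \<subseteq> D n" for n
    using B(4)[of n] by (auto simp: F_def)
  then have 3: "F \<subseteq> A"
    using D(3) FB[of 0] B(3)[of 0] by blast
  have 4: "\<exists>n. B n \<subseteq> U" if U: "openin K U" "F \<subseteq> U" for U
  proof (rule ccontr)
    assume *: "\<not> ?thesis"
    \<comment> \<open>If no \<open>B n\<close> fits into \<open>U\<close>, the sets
      \<open>K closure_of B n - U\<close> are closed, nonempty and nested; by compactness they share
      a point, which lies in \<open>F\<close> but not in \<open>U\<close>.\<close>
    have "(\<Inter>n. K closure_of B n - U) \<noteq> {}"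
    proof (rule compact_space_imp_nest[OF K(1)])
      show "closedin K (K closure_of B n - U)" for n
        using U by (simp add: closedin_diff)
      show "K closure_of B n - U \<noteq> {}" for n
        using * sub by blast
      show "decseq (\<lambda>n. K closure_of B n - U)"
        using decC by (fastforce simp: decseq_def)
    qed
    then show False
      using U by (auto simp: F_def)
  qed
  show thesis
    by (rule that[OF 1 2 3, of B]) (simp_all add: B(1) FB 4)
qed

section \<open>Embeddings and compactifications\<close>

lemma embedding_map_openin:
  assumes "embedding_map T K e" "openin T U"
  obtains V where "openin K V" "U = {x \<in> topspace T. e x \<in> V}"
proof -
  have h: "homeomorphic_map T (subtopology K (e ` topspace T)) e"
    using assms(1) by (simp add: embedding_map_def)
  have U: "U \<subseteq> topspace T"
    using assms(2) by (rule openin_subset)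
  have "openin (subtopology K (e ` topspace T)) (e ` U)"
    using homeomorphic_map_openness[OF h U] assms(2) by simp
  then obtain V where V: "openin K V" "e ` U = V \<inter> e ` topspace T"
    by (auto simp: openin_subtopology)
  moreover have "U = {x \<in> topspace T. e x \<in> V}"
  proof -
    have "e x \<in> V \<longleftrightarrow> x \<in> U" if x: "x \<in> topspace T" for x
    proof -
      have "e x \<in> V \<longleftrightarrow> e x \<in> e ` U"
        using V x by blast
      then show ?thesis
        using inj_on_image_mem_iff[OF homeomorphic_imp_injective_map[OF h] x U] by simp
    qed
    then show ?thesis
      using U by blast
  qed
  ultimately show thesis
    using that by blast
qed

lemma embedding_map_compactin_preimage:
  assumes "embedding_map T K e" "compactin K C" "C \<subseteq> e ` topspace T"
  shows "compactin T {x \<in> topspace T. e x \<in> C}"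
proof -
  have h: "homeomorphic_map T (subtopology K (e ` topspace T)) e"
    using assms(1) by (simp add: embedding_map_def)
  have "e ` {x \<in> topspace T. e x \<in> C} = C"
    using assms(3) by blast
  then have "compactin (subtopology K (e ` topspace T)) (e ` {x \<in> topspace T. e x \<in> C})"
    using assms by (simp add: compactin_subtopology)
  then show ?thesis
    using homeomorphic_map_compactness[OF h, of "{x \<in> topspace T. e x \<in> C}"] by auto
qed

lemma hausdorff_compactificationD:
  assumes "hausdorff_compactification T K e"
  shows "compact_space K" "Hausdorff_space K" "regular_space K" "embedding_map T K e"
    "K closure_of (e ` topspace T) = topspace K" "continuous_map T K e"
    "x \<in> topspace T \<Longrightarrow> e x \<in> topspace K"
    "openin K V \<Longrightarrow> V \<noteq> {} \<Longrightarrow> \<exists>x \<in> topspace T. e x \<in> V"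
proof -
  show 1: "compact_space K" "Hausdorff_space K" "embedding_map T K e"
    and d: "K closure_of (e ` topspace T) = topspace K"
    using assms by (simp_all add: hausdorff_compactification_def)
  then show "regular_space K"
    by (simp add: compact_Hausdorff_imp_regular_space)
  show c: "continuous_map T K e"
    using 1 by (meson embedding_map_def continuous_map_in_subtopology homeomorphic_imp_continuous_map)
  show "x \<in> topspace T \<Longrightarrow> e x \<in> topspace K"
    using c by (auto simp: continuous_map_def)
  show "openin K V \<Longrightarrow> V \<noteq> {} \<Longrightarrow> \<exists>x \<in> topspace T. e x \<in> V"
    using d by (auto simp: dense_intersects_open)
qed

text \<open>The image of \<open>T\<close> stays the same set, so only the labelling of its points
  changes. With \<open>h\<close> a translation, this is how homogeneity of the group acts on a
  compactification to which the translation need not extend.\<close>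

lemma hausdorff_compactification_homeomorphic:
  assumes "hausdorff_compactification T K e" "homeomorphic_map T T h"
  shows "hausdorff_compactification T K (e \<circ> h)"
proof -
  have h: "h ` topspace T = topspace T"
    using homeomorphic_imp_surjective_map[OF assms(2)] .
  then have "(e \<circ> h) ` topspace T = e ` topspace T"
    by (metis image_comp)
  moreover have "embedding_map T T h"
    using assms(2) h by (simp add: embedding_map_def)
  then have "embedding_map T K (e \<circ> h)"
    using assms(1) by (intro embedding_map_compose[of T T]) (auto simp: hausdorff_compactification_def)
  ultimately show ?thesis
    using assms(1) by (simp add: hausdorff_compactification_def)
qed

section \<open>Comparison of two compactifications\<close>

lemma in_closure_of_prod_image:
  "(x, y) \<in> prod_topology K L closure_of ((\<lambda>t. (e t, f t)) ` S) \<longleftrightarrow>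
     x \<in> topspace K \<and> y \<in> topspace L \<and>
     (\<forall>A B. openin K A \<and> openin L B \<and> x \<in> A \<and> y \<in> B \<longrightarrow> (\<exists>t\<in>S. e t \<in> A \<and> f t \<in> B))"
  (is "?l \<longleftrightarrow> ?r")
proof
  assume l: ?l
  then have *: "x \<in> topspace K" "y \<in> topspace L"
    "\<And>W. (x, y) \<in> W \<Longrightarrow> openin (prod_topology K L) W \<Longrightarrow> \<exists>t\<in>S. (e t, f t) \<in> W"
    by (auto simp: in_closure_of)
  have "\<exists>t\<in>S. e t \<in> A \<and> f t \<in> B" if "openin K A" "openin L B" "x \<in> A" "y \<in> B" for A B
    using *(3)[of "A \<times> B"] that by (auto simp: openin_prod_Times_iff)
  then show ?r
    using *(1,2) by blast
next
  assume r: ?r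
  have "\<exists>t\<in>S. (e t, f t) \<in> W" if W: "(x, y) \<in> W" "openin (prod_topology K L) W" for W
  proof -
    obtain A B where "openin K A" "openin L B" "x \<in> A" "y \<in> B" "A \<times> B \<subseteq> W"
      using W unfolding openin_prod_topology_alt by meson
    then show ?thesis
      using r by blast
  qed
  then show ?l
    using r by (auto simp: in_closure_of)
qed

text \<open>Over a point of \<open>T\<close>, the closure of the diagonal in the product of two compactifications of
  \<open>T\<close> has only the diagonal point.\<close>

lemma closure_of_diagonal_unique:
  assumes "embedding_map T K e" "continuous_map T L f" "Hausdorff_space L" "g \<in> topspace T"
    and y: "y \<in> topspace L"
    and cl: "\<And>A B. openin K A \<Longrightarrow> openin L B \<Longrightarrow> e g \<in> A \<Longrightarrow> y \<in> B \<Longrightarrow>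
      \<exists>t\<in>topspace T. e t \<in> A \<and> f t \<in> B"
  shows "y = f g"
proof (rule ccontr)
  assume "y \<noteq> f g"
  moreover have "f g \<in> topspace L"
    using assms by (auto simp: continuous_map_def)
  ultimately obtain B C where BC: "openin L B" "openin L C" "y \<in> B" "f g \<in> C" "disjnt B C"
    using assms(3) y unfolding Hausdorff_space_def by metis
  \<comment> \<open>Since \<open>T\<close> carries the topology induced by \<open>e\<close>, the
    neighbourhood of \<open>g\<close> that \<open>f\<close> maps into \<open>C\<close> is cut out by
    an open \<open>A\<close> of \<open>K\<close>. A diagonal point in \<open>A \<times> B\<close>
    would then have second coordinate in both \<open>B\<close> and \<open>C\<close>.\<close>
  have "openin T {t \<in> topspace T. f t \<in> C}"
    using assms(2) BC by (simp add: continuous_map_def)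
  then obtain A where A: "openin K A" "{t \<in> topspace T. f t \<in> C} = {t \<in> topspace T. e t \<in> A}"
    by (rule embedding_map_openin[OF assms(1)])
  then have "e g \<in> A"
    using assms(4) BC(4) by blast
  then obtain t where "t \<in> topspace T" "e t \<in> A" "f t \<in> B"
    using cl[OF A(1) BC(1)] BC(3) by blast
  then show False
    using A(2) BC(5) by (auto simp: disjnt_iff)
qed

text \<open>The closure \<open>R\<close> of the diagonal projects onto both compactifications, and the projections are
  one-to-one over \<open>T\<close>. Open sets \<open>D\<close> of \<open>K\<close> therefore pass to open sets \<open>H D\<close> of \<open>L\<close> with the same
  trace on \<open>T\<close>.\<close>

lemma residual_in_transfer:
  assumes K: "hausdorff_compactification T K e" and L: "hausdorff_compactification T L f"
    and V: "openin K V" "residual_in K V (e ` topspace T)"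
  obtains W where "openin L W" "residual_in L W (f ` topspace T)"
    "\<And>g. g \<in> topspace T \<Longrightarrow> e g \<in> V \<Longrightarrow> f g \<in> W"
proof -
  note K' = hausdorff_compactificationD[OF K]
  note L' = hausdorff_compactificationD[OF L]
  define R where "R = prod_topology K L closure_of ((\<lambda>t. (e t, f t)) ` topspace T)"
  have Riff: "(x, y) \<in> R \<longleftrightarrow> x \<in> topspace K \<and> y \<in> topspace L \<and>
     (\<forall>A B. openin K A \<and> openin L B \<and> x \<in> A \<and> y \<in> B \<longrightarrow> (\<exists>t\<in>topspace T. e t \<in> A \<and> f t \<in> B))" for x y
    unfolding R_def by (rule in_closure_of_prod_image)
  have R1: "y = f g" if "(e g, y) \<in> R" "g \<in> topspace T" for g y
    by (rule closure_of_diagonal_unique[OF K'(4) L'(6) L'(2) that(2)]) (use that Riff in auto)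
  have R2: "x = e g" if "(x, f g) \<in> R" "g \<in> topspace T" for g x
  proof (rule closure_of_diagonal_unique[OF L'(4) K'(6) K'(2) that(2)])
    show "\<exists>t\<in>topspace T. f t \<in> A \<and> e t \<in> B" if "openin L A" "openin K B" "f g \<in> A" "x \<in> B" for A B
      using that \<open>(x, f g) \<in> R\<close> Riff by blast
  qed (use that Riff in auto)
  have closedR: "closedin (prod_topology K L) R"
    by (simp add: R_def)
  \<comment> \<open>Compactness of \<open>K\<close> makes the projection to \<open>L\<close>
    closed.\<close>
  have closed_snd: "closedin L (snd ` (R \<inter> C \<times> topspace L))" if C: "closedin K C" for C
  proof -
    have "closedin (prod_topology K L) (R \<inter> C \<times> topspace L)"
      using C closedR by (intro closedin_Int) (auto simp: closedin_prod_Times_iff)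
    then show ?thesis
      using closed_map_snd[OF K'(1), of L] by (simp add: closed_map_def)
  qed
  have surj: "\<exists>x. (x, y) \<in> R" if y: "y \<in> topspace L" for y
  proof -
    have "closedin L (snd ` (R \<inter> topspace K \<times> topspace L))"
      by (rule closed_snd) simp
    moreover have "f ` topspace T \<subseteq> snd ` (R \<inter> topspace K \<times> topspace L)"
    proof
      fix z assume "z \<in> f ` topspace T"
      then obtain t where t: "t \<in> topspace T" "z = f t"
        by blast
      then have "(e t, f t) \<in> R \<inter> topspace K \<times> topspace L"
        using Riff K'(7) L'(7) by blast
      then show "z \<in> snd ` (R \<inter> topspace K \<times> topspace L)"
        using t by force
    qed
    ultimately have "topspace L \<subseteq> snd ` (R \<inter> topspace K \<times> topspace L)"
      using L'(5) closure_of_minimal by metis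
    then show ?thesis
      using y by force
  qed
  \<comment> \<open>\<open>H D\<close> consists of the points of \<open>L\<close> whose whole fibre
    in \<open>R\<close> lies in \<open>D\<close>. It contains \<open>f g\<close> when
    \<open>e g \<in> D\<close>, because the fibre over \<open>f g\<close> is just
    \<open>e g\<close>.\<close>
  define H where "H D = topspace L - snd ` (R \<inter> (topspace K - D) \<times> topspace L)" for D
  have H_open: "openin L (H D)" if "openin K D" for D
    unfolding H_def using closed_snd[of "topspace K - D"] that by blast
  have H_diag: "f g \<in> H D" if "g \<in> topspace T" "e g \<in> D" for g D
    using that R2 L'(7) by (force simp: H_def)
  have H_D: "x \<in> D" if "y \<in> H D" "(x, y) \<in> R" for x y D
  proof (rule ccontr)
    assume "x \<notin> D"
    then have "(x, y) \<in> R \<inter> (topspace K - D) \<times> topspace L"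
      using that Riff by blast
    then have "y \<in> snd ` (R \<inter> (topspace K - D) \<times> topspace L)"
      by force
    then show False
      using that by (simp add: H_def)
  qed
  have H_dense: "L closure_of H D = topspace L" if D: "openin K D" "K closure_of D = topspace K" for D
    unfolding dense_intersects_open
  proof (intro allI impI)
    fix A assume A: "openin L A \<and> A \<noteq> {}"
    have "openin T {t \<in> topspace T. f t \<in> A}"
      using A L'(6) by (simp add: continuous_map_def)
    then obtain B where B: "openin K B" "{t \<in> topspace T. f t \<in> A} = {t \<in> topspace T. e t \<in> B}"
      by (rule embedding_map_openin[OF K'(4)])
    obtain t where "t \<in> topspace T" "f t \<in> A"
      using L'(8) A by blast
    then have "B \<noteq> {}"
      using B(2) by blast
    then have "B \<inter> D \<noteq> {}" "openin K (B \<inter> D)"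
      using B D by (auto simp: dense_intersects_open)
    then obtain s where "s \<in> topspace T" "e s \<in> B \<inter> D"
      using K'(8) by blast
    then have "f s \<in> H D \<inter> A"
      using B(2) H_diag by blast
    then show "H D \<inter> A \<noteq> {}"
      by blast
  qed
  obtain D :: "nat \<Rightarrow> _" where D: "\<forall>n. openin K (D n) \<and> K closure_of D n = topspace K"
      "V \<inter> (\<Inter>n. D n) \<subseteq> e ` topspace T"
    using V(2) unfolding residual_in_def by (elim exE conjE) (rule that)
  \<comment> \<open>The fibre of such a \<open>y\<close> is nonempty and lies in \<open>V\<close>
    and in every \<open>D n\<close>, so it contains some \<open>e g\<close>; uniqueness over
    \<open>e g\<close> then gives \<open>y = f g\<close>.\<close>
  have "H V \<inter> (\<Inter>n. H (D n)) \<subseteq> f ` topspace T"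
  proof
    fix y assume y: "y \<in> H V \<inter> (\<Inter>n. H (D n))"
    then have "y \<in> topspace L"
      by (simp add: H_def)
    then obtain x where x: "(x, y) \<in> R"
      using surj by blast
    then have "x \<in> V \<inter> (\<Inter>n. D n)"
      using y H_D by blast
    then obtain g where "g \<in> topspace T" "x = e g"
      using D(2) by blast
    then show "y \<in> f ` topspace T"
      using R1 x by blast
  qed
  then have "residual_in L (H V) (f ` topspace T)"
    unfolding residual_in_def using D H_open H_dense by (intro exI[of _ "\<lambda>n. H (D n)"]) blast
  then show thesis
    using that[OF H_open[OF V(1)]] H_diag by blast
qed

section \<open>Lindelof remainders\<close>

text \<open>One half of the Henriksen--Isbell theorem.\<close>

lemma Lindelof_space_remainder:
  assumes K: "hausdorff_compactification T K e"
    and type: "\<And>C. compactin T C \<Longrightarrow> \<exists>P B. compactin T P \<and> C \<subseteq> P \<and>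
      (\<forall>n::nat. openin T (B n) \<and> P \<subseteq> B n) \<and> (\<forall>U. openin T U \<and> P \<subseteq> U \<longrightarrow> (\<exists>n. B n \<subseteq> U))"
  shows "Lindelof_space (remainder T K e)"
proof -
  note K' = hausdorff_compactificationD[OF K]
  let ?Y = "topspace K - e ` topspace T"
  have "\<exists>\<V>. countable \<V> \<and> \<V> \<subseteq> \<U> \<and> ?Y \<subseteq> \<Union>\<V>"
    if \<U>: "\<And>U. U \<in> \<U> \<Longrightarrow> openin K U" "?Y \<subseteq> \<Union>\<U>" for \<U>
  proof -
    \<comment> \<open>The part of \<open>K\<close> missed by the cover is compact and lies in the
      image of \<open>T\<close>, so it can be enlarged to a compact \<open>P\<close> with a
      countable neighbourhood base.\<close>
    define C where "C = topspace K - \<Union>\<U>"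
    have "closedin K C"
      unfolding C_def using \<U>(1) by (intro closedin_diff openin_Union) auto
    then have "compactin K C"
      using K'(1) closedin_compact_space by blast
    moreover have CT: "C \<subseteq> e ` topspace T"
      using \<U>(2) by (auto simp: C_def)
    ultimately have "compactin T {x \<in> topspace T. e x \<in> C}"
      by (rule embedding_map_compactin_preimage[OF K'(4)])
    from type[OF this] obtain P B where P: "compactin T P" "{x \<in> topspace T. e x \<in> C} \<subseteq> P"
      and B: "\<forall>n::nat. openin T (B n) \<and> P \<subseteq> B n"
      and base: "\<forall>U. openin T U \<and> P \<subseteq> U \<longrightarrow> (\<exists>n. B n \<subseteq> U)"
      by (elim exE conjE) (rule that)
    have "\<forall>n. \<exists>B'. openin K B' \<and> B n = {x \<in> topspace T. e x \<in> B'}"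
      using B embedding_map_openin[OF K'(4)] by metis
    then obtain B' where B': "\<forall>n. openin K (B' n) \<and> B n = {x \<in> topspace T. e x \<in> B' n}"
      by (elim choice[THEN exE])
    have PT: "P \<subseteq> topspace T"
      using P(1) by (rule compactin_subset_topspace)
    have CP: "C \<subseteq> e ` P"
      using CT P(2) by blast
    have PB: "e ` P \<subseteq> B' n" for n
      using B B' by blast
    have "compactin K (e ` P)"
      using P(1) K'(6) by (rule image_compactin)
    then have closedP: "closedin K (e ` P)"
      using K'(2) by (rule compactin_imp_closedin[rotated])
    have "\<exists>\<V>. finite \<V> \<and> \<V> \<subseteq> \<U> \<and> topspace K - B' n \<subseteq> \<Union>\<V>" for n
    proof -
      have "compactin K (topspace K - B' n)"
        using B' K'(1) by (meson closedin_compact_space closedin_diff closedin_topspace)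
      moreover have "topspace K - B' n \<subseteq> \<Union>\<U>"
        using order_trans[OF CP PB[of n]] by (auto simp only: C_def)
      ultimately show ?thesis
        using \<U>(1) by (simp add: compactin_def)
    qed
    then obtain \<V> where \<V>: "\<And>n. finite (\<V> n)" "\<And>n. \<V> n \<subseteq> \<U>" "\<And>n. topspace K - B' n \<subseteq> \<Union>(\<V> n)"
      by metis
    have "?Y \<subseteq> \<Union>(\<Union>n. \<V> n)"
    proof
      fix y assume y: "y \<in> ?Y"
      then have "y \<in> topspace K - e ` P"
        using PT by blast
      moreover have "openin K (topspace K - e ` P)"
        using closedP by blast
      ultimately obtain W where W: "openin K W" "y \<in> W" "K closure_of W \<subseteq> topspace K - e ` P"
        using regular_space_shrink[OF K'(3)] by blast
      define U where "U = topspace K - K closure_of W"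
      have U: "openin K U"
        by (simp add: U_def openin_diff)
      have UW: "U \<inter> W = {}"
        using closure_of_subset[OF openin_subset[OF W(1)]] by (auto simp: U_def)
      have "openin T {x \<in> topspace T. e x \<in> U}"
        using U K'(6) by (simp add: continuous_map_def)
      moreover have "P \<subseteq> {x \<in> topspace T. e x \<in> U}"
        using PT W(3) K'(7) by (auto simp: U_def)
      ultimately obtain n where n: "B n \<subseteq> {x \<in> topspace T. e x \<in> U}"
        using base by blast
      \<comment> \<open>The trace of \<open>B' n\<close> on \<open>T\<close> lies in
        \<open>U\<close>, which misses the neighbourhood \<open>W\<close> of \<open>y\<close>. Were
        \<open>y\<close> in \<open>B' n\<close>, the open set \<open>B' n \<inter> W\<close> would
        contain a point of the dense image of \<open>T\<close>.\<close>
      have "y \<notin> B' n"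
      proof
        assume "y \<in> B' n"
        then have "B' n \<inter> W \<noteq> {}" "openin K (B' n \<inter> W)"
          using W B' by auto
        then obtain x where "x \<in> topspace T" "e x \<in> B' n \<inter> W"
          using K'(8) by blast
        then show False
          using n B' UW by blast
      qed
      then have "y \<in> \<Union>(\<V> n)"
        using \<V>(3)[of n] y by (simp add: subset_eq)
      then show "y \<in> \<Union>(\<Union>n. \<V> n)"
        by auto
    qed
    moreover have "countable (\<Union>n. \<V> n)"
      using \<V>(1) by (simp add: countable_finite)
    moreover have "(\<Union>n. \<V> n) \<subseteq> \<U>"
      using \<V>(2) by (rule UN_least)
    ultimately show ?thesis
      by (intro exI conjI)
  qed
  then have "\<forall>\<U>. (\<forall>U \<in> \<U>. openin K U) \<and> ?Y \<subseteq> \<Union>\<U> \<longrightarrow>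
      (\<exists>\<V>. countable \<V> \<and> \<V> \<subseteq> \<U> \<and> ?Y \<subseteq> \<Union>\<V>)"
    by simp
  then show ?thesis
    unfolding remainder_def Lindelof_space_subtopology_subset[OF Diff_subset] .
qed

section \<open>Category in the remainder\<close>

lemma nowhere_dense_in_dense_subtopology:
  assumes "K closure_of Y = topspace K" "Y \<subseteq> topspace K"
    and D: "openin K D" "K closure_of D = topspace K"
  shows "nowhere_dense_in (subtopology K Y) (Y - D)"
  unfolding nowhere_dense_in_iff
proof (intro conjI allI impI)
  fix U assume U: "openin (subtopology K Y) U \<and> U \<noteq> {}"
  then obtain A where A: "openin K A" "U = A \<inter> Y"
    by (auto simp: openin_subtopology)
  then have "A \<noteq> {}"
    using U by blast
  then have "D \<inter> A \<noteq> {}"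
    using A D by (simp add: dense_intersects_open)
  moreover have "openin K (D \<inter> A)"
    using A D by blast
  ultimately have "Y \<inter> (D \<inter> A) \<noteq> {}"
    using assms(1) unfolding dense_intersects_open by blast
  moreover have "openin (subtopology K Y) (D \<inter> A \<inter> Y)"
    using \<open>openin K (D \<inter> A)\<close> by (auto simp: openin_subtopology)
  ultimately show "\<exists>V. openin (subtopology K Y) V \<and> V \<noteq> {} \<and> V \<subseteq> U \<and> V \<inter> (Y - D) = {}"
    using A by (intro exI[of _ "D \<inter> A \<inter> Y"]) auto
qed (use assms in auto)

text \<open>Where the image of \<open>T\<close> is residual, each point of the remainder misses some
  \<open>D n\<close>, so the remainder is there covered by the nowhere dense sets
  \<open>?Y - D n\<close>. By \<open>res\<close> such places occur inside every nonempty open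
  set.\<close>

lemma meager_space_remainder:
  assumes dense: "K closure_of (topspace K - e ` topspace T) = topspace K"
    and res: "\<And>A. openin K A \<Longrightarrow> A \<noteq> {} \<Longrightarrow>
      \<exists>W. openin K W \<and> W \<inter> A \<noteq> {} \<and> residual_in K W (e ` topspace T)"
  shows "meager_space (remainder T K e)"
  unfolding remainder_def
proof (rule meager_space_if_pi_base)
  let ?Y = "topspace K - e ` topspace T"
  fix U assume U: "openin (subtopology K ?Y) U" "U \<noteq> {}"
  then obtain A where A: "openin K A" "U = A \<inter> ?Y"
    by (auto simp: openin_subtopology)
  then obtain W where W: "openin K W" "W \<inter> A \<noteq> {}" "residual_in K W (e ` topspace T)"
    using res U(2) by blast
  then obtain D :: "nat \<Rightarrow> _" where D: "\<forall>n. openin K (D n) \<and> K closure_of D n = topspace K"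
      "W \<inter> (\<Inter>n. D n) \<subseteq> e ` topspace T"
    unfolding residual_in_def by (elim exE conjE) (rule that)
  have WA: "openin K (W \<inter> A)"
    using W A by blast
  show "\<exists>V N. openin (subtopology K ?Y) V \<and> V \<noteq> {} \<and> V \<subseteq> U \<and>
    (\<forall>n::nat. nowhere_dense_in (subtopology K ?Y) (N n)) \<and> V \<subseteq> (\<Union>n. N n)"
  proof (intro exI conjI allI)
    show "openin (subtopology K ?Y) (W \<inter> A \<inter> ?Y)"
      using WA by (auto simp: openin_subtopology)
    show "W \<inter> A \<inter> ?Y \<noteq> {}"
      using dense WA W(2) unfolding dense_intersects_open by blast
    show "W \<inter> A \<inter> ?Y \<subseteq> U"
      using A by blast
    show "nowhere_dense_in (subtopology K ?Y) (?Y - D n)" for n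
      using D(1) by (intro nowhere_dense_in_dense_subtopology dense) auto
    show "W \<inter> A \<inter> ?Y \<subseteq> (\<Union>n. ?Y - D n)"
      using D(2) by blast
  qed
qed

text \<open>Dense open sets of the remainder whose intersection misses a nonempty open
  \<open>S\<close> extend to open sets \<open>D n\<close> of \<open>K\<close>, dense because the
  remainder is. If \<open>V\<close> extends \<open>S\<close>, no point of the remainder lies in
  \<open>V\<close> and in all \<open>D n\<close>.\<close>

lemma residual_in_if_not_baire_remainder:
  assumes dense: "K closure_of (topspace K - e ` topspace T) = topspace K"
    and "\<not> baire_space (remainder T K e)"
  obtains V where "openin K V" "V \<noteq> {}" "residual_in K V (e ` topspace T)"
proof -
  let ?Y = "topspace K - e ` topspace T"
  obtain U :: "nat \<Rightarrow> _" where U: "\<forall>n. openin (subtopology K ?Y) (U n) \<and>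
        subtopology K ?Y closure_of U n = topspace (subtopology K ?Y)"
      "subtopology K ?Y closure_of (\<Inter>n. U n) \<noteq> topspace (subtopology K ?Y)"
    using assms(2) unfolding baire_space_def remainder_def by blast
  have "\<forall>n. \<exists>A. openin K A \<and> U n = A \<inter> ?Y"
    using U(1) by (auto simp: openin_subtopology)
  then obtain D where D: "\<forall>n. openin K (D n) \<and> U n = D n \<inter> ?Y"
    by (elim choice[THEN exE])
  obtain S where S: "openin (subtopology K ?Y) S" "S \<noteq> {}" "(\<Inter>n. U n) \<inter> S = {}"
    using U(2) unfolding dense_intersects_open by blast
  then obtain V where V: "openin K V" "S = V \<inter> ?Y"
    by (auto simp: openin_subtopology)
  have "K closure_of D n = topspace K" for n
    unfolding dense_intersects_open
  proof (intro allI impI)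
    fix A assume A: "openin K A \<and> A \<noteq> {}"
    then have "A \<inter> ?Y \<noteq> {}"
      using dense unfolding dense_intersects_open by blast
    moreover have "openin (subtopology K ?Y) (A \<inter> ?Y)"
      using A by (auto simp: openin_subtopology)
    ultimately have "U n \<inter> (A \<inter> ?Y) \<noteq> {}"
      using U(1) unfolding dense_intersects_open by blast
    then show "D n \<inter> A \<noteq> {}"
      using D by blast
  qed
  moreover have "V \<inter> (\<Inter>n. D n) \<subseteq> e ` topspace T"
  proof
    fix x assume x: "x \<in> V \<inter> (\<Inter>n. D n)"
    show "x \<in> e ` topspace T"
    proof (rule ccontr)
      assume "x \<notin> e ` topspace T"
      then have xY: "x \<in> ?Y"
        using x openin_subset[OF V(1)] by blast
      then have "x \<in> (\<Inter>n. U n)"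
        using x D by blast
      then show False
        using S(3) V(2) x xY by blast
    qed
  qed
  ultimately have "residual_in K V (e ` topspace T)"
    using D unfolding residual_in_def by blast
  moreover have "V \<noteq> {}"
    using S V by blast
  ultimately show thesis
    using that V(1) by blast
qed

section \<open>Homogeneity and countable type in paratopological groups\<close>

context paratopological_group
begin

text \<open>The inverse of a left translation is the left translation by \<open>inv a\<close>, so
  both are continuous by continuity of the product.\<close>

lemma homeomorphic_map_left_mult:
  assumes "a \<in> carrier G"
  shows "homeomorphic_map T T (\<lambda>x. a \<otimes> x)"
proof -
  have c: "continuous_map T T (\<lambda>x. b \<otimes> x)" if "b \<in> carrier G" for b
  proof -
    have "continuous_map T (prod_topology T T) (\<lambda>x. (b, x))"
      using that by (simp add: continuous_map_pairwise o_def topspace_carrier)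
    from continuous_map_compose[OF this continuous_mult] show ?thesis
      by (simp add: o_def)
  qed
  have "homeomorphic_maps T T (\<lambda>x. a \<otimes> x) (\<lambda>x. inv a \<otimes> x)"
    unfolding homeomorphic_maps_def
    using assms c by (simp add: topspace_carrier m_assoc[symmetric])
  then show ?thesis
    by (rule homeomorphic_maps_imp_map)
qed

lemma continuous_map_right_mult:
  assumes "a \<in> carrier G"
  shows "continuous_map T T (\<lambda>x. x \<otimes> a)"
proof -
  have "continuous_map T (prod_topology T T) (\<lambda>x. (x, a))"
    using assms by (simp add: continuous_map_pairwise o_def topspace_carrier)
  from continuous_map_compose[OF this continuous_mult] show ?thesis
    by (simp add: o_def)
qed

text \<open>Left translation by \<open>y \<otimes> inv x\<close> carries the compact neighbourhood
  of \<open>x\<close> to one of \<open>y\<close>.\<close>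

lemma locally_compact_space_if_at_point:
  assumes "openin T U" "compactin T C" "x \<in> U" "U \<subseteq> C"
  shows "locally_compact_space T"
  unfolding locally_compact_space_def
proof (intro ballI)
  fix y assume y: "y \<in> topspace T"
  have x: "x \<in> carrier G"
    using assms(1,3) openin_subset topspace_carrier by blast
  let ?h = "\<lambda>z. (y \<otimes> inv x) \<otimes> z"
  have a: "y \<otimes> inv x \<in> carrier G"
    using x y topspace_carrier by simp
  have h: "homeomorphic_map T T ?h"
    by (rule homeomorphic_map_left_mult[OF a])
  show "\<exists>V D. openin T V \<and> compactin T D \<and> y \<in> V \<and> V \<subseteq> D"
  proof (intro exI conjI)
    show "openin T (?h ` U)"
      using homeomorphic_map_openness[OF h openin_subset[OF assms(1)]] assms(1) by simp
    show "compactin T (?h ` C)"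
      using assms(2) homeomorphic_imp_continuous_map[OF h] by (rule image_compactin)
    have "?h x = y"
      using x y by (simp add: topspace_carrier m_assoc)
    then show "y \<in> ?h ` U"
      using assms(3) by (metis imageI)
    show "?h ` U \<subseteq> ?h ` C"
      using assms(4) by blast
  qed
qed

text \<open>A nonempty open set missing the remainder lies in the image of \<open>T\<close>. A
  smaller closure inside it is compact and pulls back to a compact neighbourhood of one point of
  \<open>T\<close>, which forces local compactness everywhere.\<close>

lemma dense_remainder:
  assumes K: "hausdorff_compactification T K e" and nlc: "\<not> locally_compact_space T"
  shows "K closure_of (topspace K - e ` topspace T) = topspace K"
  unfolding dense_intersects_open
proof (intro allI impI notI)
  note K' = hausdorff_compactificationD[OF K]
  fix A assume A: "openin K A \<and> A \<noteq> {}" and "(topspace K - e ` topspace T) \<inter> A = {}"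
  then have AT: "A \<subseteq> e ` topspace T"
    using openin_subset[of K A] by blast
  obtain x where x: "x \<in> topspace T" "e x \<in> A"
    using A K'(8) by blast
  then obtain W where W: "openin K W" "e x \<in> W" "K closure_of W \<subseteq> A"
    using regular_space_shrink[OF K'(3)] A by metis
  have "compactin K (K closure_of W)"
    using K'(1) by (simp add: closedin_compact_space)
  then have "compactin T {t \<in> topspace T. e t \<in> K closure_of W}"
    using W(3) AT by (intro embedding_map_compactin_preimage[OF K'(4)]) auto
  moreover have "openin T {t \<in> topspace T. e t \<in> W}"
    using W K'(6) by (simp add: continuous_map_def)
  moreover have "W \<subseteq> K closure_of W"
    using W by (simp add: closure_of_subset openin_subset)
  ultimately have "locally_compact_space T"
    using x W(2) by (intro locally_compact_space_if_at_point[of "{t \<in> topspace T. e t \<in> W}" _ x]) auto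
  then show False
    using nlc by simp
qed

text \<open>If \<open>F\<close> is compact with countable neighbourhood base \<open>B\<close>, then by Wallace's theorem \<open>C F\<close> has the
  countable base \<open>C (B n)\<close> for every compact \<open>C\<close>, and a right translate of \<open>C F\<close> contains \<open>C\<close>.\<close>

lemma countable_type_if_compact_set_of_countable_character:
  assumes F: "compactin T F" "F \<noteq> {}"
    and B: "\<forall>n::nat. openin T (B n) \<and> F \<subseteq> B n"
    and base: "\<forall>U. openin T U \<and> F \<subseteq> U \<longrightarrow> (\<exists>n. B n \<subseteq> U)"
    and C: "compactin T C"
  shows "\<exists>P B'. compactin T P \<and> C \<subseteq> P \<and>
    (\<forall>n::nat. openin T (B' n) \<and> P \<subseteq> B' n) \<and> (\<forall>U. openin T U \<and> P \<subseteq> U \<longrightarrow> (\<exists>n. B' n \<subseteq> U))"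
proof -
  let ?m = "\<lambda>(x, y). x \<otimes> y"
  obtain f where f: "f \<in> F"
    using F(2) by blast
  have FG: "F \<subseteq> carrier G" and CG: "C \<subseteq> carrier G"
    using compactin_subset_topspace[OF F(1)] compactin_subset_topspace[OF C]
    by (simp_all add: topspace_carrier)
  then have fG: "f \<in> carrier G"
    using f by blast
  \<comment> \<open>Translating by \<open>inv f\<close> first ensures
    \<open>C \<subseteq> C' F\<close>, since
    \<open>c = (c \<otimes> inv f) \<otimes> f\<close>.\<close>
  define C' where "C' = (\<lambda>c. c \<otimes> inv f) ` C"
  have C': "compactin T C'"
    unfolding C'_def by (rule image_compactin[OF C continuous_map_right_mult]) (simp add: fG)
  have C'G: "C' \<subseteq> carrier G"
    using CG fG by (auto simp: C'_def)
  define P where "P = ?m ` (C' \<times> F)"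
  define B' where "B' n = (\<Union>c\<in>C'. (\<lambda>y. c \<otimes> y) ` B n)" for n
  have "compactin T P"
    unfolding P_def using C' F(1)
    by (intro image_compactin[OF _ continuous_mult]) (simp add: compactin_Times)
  moreover have "C \<subseteq> P"
  proof
    fix c assume c: "c \<in> C"
    then have "c = ?m (c \<otimes> inv f, f)"
      using CG fG by (simp add: m_assoc subsetD)
    moreover have "(c \<otimes> inv f, f) \<in> C' \<times> F"
      using c f by (simp add: C'_def)
    ultimately show "c \<in> P"
      unfolding P_def by (rule image_eqI)
  qed
  moreover have "openin T (B' n)" for n
    unfolding B'_def
  proof (intro openin_Union ballI, elim imageE)
    fix S c assume c: "c \<in> C'" and S: "S = (\<lambda>y. c \<otimes> y) ` B n"
    have "homeomorphic_map T T (\<lambda>y. c \<otimes> y)"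
      using c C'G by (intro homeomorphic_map_left_mult) blast
    moreover have "openin T (B n)"
      using B by simp
    ultimately show "openin T S"
      unfolding S using homeomorphic_map_openness openin_subset by metis
  qed
  moreover have "P \<subseteq> B' n" for n
  proof
    fix p assume "p \<in> P"
    then obtain c y where "c \<in> C'" "y \<in> F" "p = c \<otimes> y"
      by (auto simp: P_def)
    then show "p \<in> B' n"
      using B by (auto simp: B'_def)
  qed
  moreover have "\<exists>n. B' n \<subseteq> U" if U: "openin T U" "P \<subseteq> U" for U
  proof -
    have W: "openin (prod_topology T T) {p \<in> topspace (prod_topology T T). ?m p \<in> U}"
      using continuous_mult U(1) by (rule openin_continuous_map_preimage)
    have sub: "C' \<times> F \<subseteq> {p \<in> topspace (prod_topology T T). ?m p \<in> U}"
      using U(2) C'G FG by (auto simp: P_def topspace_carrier)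
    \<comment> \<open>\<open>C' \<times> F\<close> lies in the open preimage of \<open>U\<close>
      under multiplication; a box \<open>V \<times> W\<close> fits in between, and some
      \<open>B n\<close> lies in \<open>W\<close>.\<close>
    from Wallace_theorem_prod_topology[OF C' F(1) W sub]
    obtain V W where VW: "openin T W" "C' \<subseteq> V" "F \<subseteq> W"
      "V \<times> W \<subseteq> {p \<in> topspace (prod_topology T T). ?m p \<in> U}" .
    have "\<exists>n. B n \<subseteq> W"
      using base VW(1,3) by simp
    then obtain n where "B n \<subseteq> W"
      by (rule exE)
    have "B' n \<subseteq> U"
    proof
      fix p assume "p \<in> B' n"
      then obtain c y where "c \<in> C'" "y \<in> B n" and p: "p = c \<otimes> y"
        by (auto simp: B'_def)
      then have "(c, y) \<in> V \<times> W"
        using VW(2) \<open>B n \<subseteq> W\<close> by blast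
      then show "p \<in> U"
        using subsetD[OF VW(4)] p by fastforce
    qed
    then show ?thesis
      by (rule exI)
  qed
  ultimately show ?thesis
    by (intro exI[of _ P] exI[of _ B']) simp
qed

end

section \<open>Dichotomy for the remainders\<close>

theorem theorem3p1:
  fixes G :: "('a, 'm) monoid_scheme" and T :: "'a topology"
  assumes "paratopological_group G T"
    and "tychonoff_space T"
    and "\<not> locally_compact_space T"
  shows "(\<forall>(K :: 'b topology) e. hausdorff_compactification T K e \<longrightarrow>
            baire_space (remainder T K e)) \<or>
         (\<forall>(K :: 'c topology) e. hausdorff_compactification T K e \<longrightarrow>
            meager_space (remainder T K e) \<and> Lindelof_space (remainder T K e))"
proof (rule disjCI)
  interpret paratopological_group G T
    by (rule assms(1))
  assume "\<not> (\<forall>(K :: 'c topology) e. hausdorff_compactification T K e \<longrightarrow>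
            meager_space (remainder T K e) \<and> Lindelof_space (remainder T K e))"
  then obtain L :: "'c topology" and f where L: "hausdorff_compactification T L f"
    and bad: "\<not> (meager_space (remainder T L f) \<and> Lindelof_space (remainder T L f))"
    by blast
  note L' = hausdorff_compactificationD[OF L]
  \<comment> \<open>A single non-Baire remainder, in any \<open>K\<close>, will make the remainder
    in the fixed \<open>L\<close> both meager and Lindelof.\<close>
  show "\<forall>(K :: 'b topology) e. hausdorff_compactification T K e \<longrightarrow> baire_space (remainder T K e)"
  proof (intro allI impI, rule ccontr)
    fix K :: "'b topology" and e
    assume K: "hausdorff_compactification T K e" and "\<not> baire_space (remainder T K e)"
    then obtain V where V: "openin K V" "V \<noteq> {}" "residual_in K V (e ` topspace T)"
      using residual_in_if_not_baire_remainder[OF dense_remainder[OF K assms(3)]] by blast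
    obtain h where h: "h \<in> topspace T" "e h \<in> V"
      using hausdorff_compactificationD(8)[OF K V(1,2)] by blast
    have res: "\<exists>W. openin L W \<and> W \<inter> A \<noteq> {} \<and> residual_in L W (f ` topspace T)"
      if A: "openin L A" "A \<noteq> {}" for A
    proof -
      obtain x where x: "x \<in> topspace T" "f x \<in> A"
        using L'(8)[OF A] by blast
      \<comment> \<open>The translation by \<open>a\<close> takes \<open>h\<close>, which
        \<open>e\<close> sends into \<open>V\<close>, to \<open>x\<close>, which \<open>f\<close>
        sends into \<open>A\<close>. Transferring \<open>V\<close> to \<open>L\<close> along
        \<open>f\<close> composed with this translation therefore gives a \<open>W\<close> that
        contains \<open>f x\<close> and so meets \<open>A\<close>.\<close>
      define a where "a = x \<otimes>\<^bsub>G\<^esub> inv\<^bsub>G\<^esub> h"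
      let ?t = "\<lambda>z. a \<otimes>\<^bsub>G\<^esub> z"
      have "a \<in> carrier G"
        using x h by (simp add: a_def topspace_carrier)
      then have t: "homeomorphic_map T T ?t"
        by (rule homeomorphic_map_left_mult)
      have ax: "?t h = x"
        using x h by (simp add: a_def topspace_carrier m_assoc)
      obtain W where W: "openin L W" "residual_in L W ((f \<circ> ?t) ` topspace T)"
          "\<And>g. g \<in> topspace T \<Longrightarrow> e g \<in> V \<Longrightarrow> (f \<circ> ?t) g \<in> W"
        using residual_in_transfer[OF K hausdorff_compactification_homeomorphic[OF L t] V(1,3)]
        by metis
      have "(f \<circ> ?t) ` topspace T = f ` topspace T"
        by (metis image_comp homeomorphic_imp_surjective_map[OF t])
      moreover have "f x \<in> W"
        using W(3)[OF h] ax by simp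
      ultimately show ?thesis
        using W(1,2) x by auto
    qed
    have "meager_space (remainder T L f)"
      by (rule meager_space_remainder[OF dense_remainder[OF L assms(3)] res])
    moreover have "Lindelof_space (remainder T L f)"
    proof (rule Lindelof_space_remainder[OF L])
      fix C assume C: "compactin T C"
      obtain F B where F: "compactin K F" "F \<noteq> {}" "F \<subseteq> e ` topspace T"
        and B: "\<forall>n::nat. openin K (B n) \<and> F \<subseteq> B n" "\<forall>U. openin K U \<and> F \<subseteq> U \<longrightarrow> (\<exists>n. B n \<subseteq> U)"
        using compact_set_of_countable_character[OF hausdorff_compactificationD(1,2)[OF K] V]
        by metis
      show "\<exists>P B. compactin T P \<and> C \<subseteq> P \<and>
        (\<forall>n::nat. openin T (B n) \<and> P \<subseteq> B n) \<and> (\<forall>U. openin T U \<and> P \<subseteq> U \<longrightarrow> (\<exists>n. B n \<subseteq> U))"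
      proof (rule countable_type_if_compact_set_of_countable_character[OF _ _ _ _ C])
        \<comment> \<open>\<open>F\<close> lies in the image of \<open>T\<close>, so
          \<open>F\<close> and its neighbourhood base in \<open>K\<close> pull back to a compact set
          of countable character in \<open>T\<close>.\<close>
        let ?p = "\<lambda>S. {x \<in> topspace T. e x \<in> S}"
        show "compactin T (?p F)"
          by (rule embedding_map_compactin_preimage[OF hausdorff_compactificationD(4)[OF K] F(1,3)])
        show "?p F \<noteq> {}"
          using F by blast
        show "\<forall>n::nat. openin T (?p (B n)) \<and> ?p F \<subseteq> ?p (B n)"
          using B(1) hausdorff_compactificationD(6)[OF K] by (auto simp: continuous_map_def)
        show "\<forall>U. openin T U \<and> ?p F \<subseteq> U \<longrightarrow> (\<exists>n. ?p (B n) \<subseteq> U)"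
        proof (intro allI impI)
          fix U assume U: "openin T U \<and> ?p F \<subseteq> U"
          obtain U' where U': "openin K U'" "U = ?p U'"
            using embedding_map_openin[OF hausdorff_compactificationD(4)[OF K]] U by blast
          then have "F \<subseteq> U'"
            using U F(3) by blast
          then obtain n where "B n \<subseteq> U'"
            using B(2) U' by blast
          then show "\<exists>n. ?p (B n) \<subseteq> U"
            using U'(2) by blast
        qed
      qed
    qed
    ultimately show False
      using bad by simp
  qed
qed

end
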